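(* Let $G=(V,E)$ be an unweighted multigraph with $n$ nodes and edge connectivity $\lambda$, and let $\epsilon\in(0,1)$. Set $p=\frac{\epsilon\log n}{2\lambda}$ and $L=20\log n$. Perform the following experiment: each edge $e\in E$ is independently included in a sampled set $S$ with probability $p$, and each edge is independently assigned a layer number chosen uniformly at random from $\{1,\dots,L\}$. For $i\in\{1,\dots,L\}$ let $S_i$ be the set of sampled edges with layer number $i$, let $S_{i-}=\bigcup_{j=1}^{i}S_j$, and let $G_i=(V,S_{i-})$. Let $\mathcal{F}$ be the collection consisting of all cuts $(\mathcal{C},V\setminus\mathcal{C})$ where $\mathcal{C}$ ranges over the connected components of $G_i$, for all $i\in\{1,\dots,L-1\}$. Then $$\Pr[\mathcal{F}\text{ contains an }O(\epsilon^{-1})\text{-minimum cut of }G]\ \ge\ n^{-\epsilon}/2.$$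
   Context: For a nonempty proper subset $C\subset V$, the cut $(C,V\setminus C)$ is the set of edges (counted with multiplicity) with exactly one endpoint in $C$, and its size is the number of such edges. The edge connectivity $\lambda$ is the minimum cut size over all nonempty proper subsets; a cut is $\alpha$-minimum if its size is at most $\alpha\lambda$. *)

theory Defs
  imports "HOL-Probability.Probability"
begin

text \<open>
  Edges have an identity of their own, so that parallel edges are sampled and layered separately.
  Loops are allowed; they never cross a cut.
\<close>

record ('v, 'e) multigraph =
  verts :: "'v set"
  edges :: "'e set"
  ends :: "'e \<Rightarrow> 'v set"

definition finite_multigraph :: "('v, 'e) multigraph \<Rightarrow> bool" where
  "finite_multigraph G \<longleftrightarrow> finite (verts G) \<and> finite (edges G) \<and>
     (\<forall>e\<in>edges G. ends G e \<subseteq> verts G \<and> card (ends G e) \<in> {1, 2})"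

definition cuts :: "('v, 'e) multigraph \<Rightarrow> ('v set \<times> 'v set) set" where
  "cuts G = {(C, verts G - C) | C. C \<noteq> {} \<and> C \<subset> verts G}"

definition cut_edges :: "('v, 'e) multigraph \<Rightarrow> 'v set \<times> 'v set \<Rightarrow> 'e set" where
  "cut_edges G = (\<lambda>(C, D). {e \<in> edges G. ends G e \<inter> C \<noteq> {} \<and> ends G e \<inter> D \<noteq> {}})"

definition cut_size :: "('v, 'e) multigraph \<Rightarrow> 'v set \<times> 'v set \<Rightarrow> nat" where
  "cut_size G X = card (cut_edges G X)"

text \<open>Only meaningful if there are at least two vertices; otherwise there are no cuts.\<close>

definition edge_connectivity :: "('v, 'e) multigraph \<Rightarrow> nat" where
  "edge_connectivity G = Min (cut_size G ` cuts G)"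

definition minimum_cut :: "real \<Rightarrow> ('v, 'e) multigraph \<Rightarrow> 'v set \<times> 'v set \<Rightarrow> bool" where
  "minimum_cut \<alpha> G X \<longleftrightarrow>
     X \<in> cuts G \<and> real (cut_size G X) \<le> \<alpha> * real (edge_connectivity G)"

definition adjacency :: "('v, 'e) multigraph \<Rightarrow> ('v \<times> 'v) set" where
  "adjacency G = {(u, v). \<exists>e\<in>edges G. ends G e = {u, v}}"

definition components :: "('v, 'e) multigraph \<Rightarrow> 'v set set" where
  "components G = {{v \<in> verts G. (u, v) \<in> (adjacency G)\<^sup>*} | u. u \<in> verts G}"

definition sampling_prob :: "real \<Rightarrow> ('v, 'e) multigraph \<Rightarrow> real" where
  "sampling_prob \<epsilon> G =
     \<epsilon> * log 2 (real (card (verts G))) / (2 * real (edge_connectivity G))"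

text \<open>The number of layers has to be an integer, so it is rounded up.\<close>

definition num_layers :: "('v, 'e) multigraph \<Rightarrow> nat" where
  "num_layers G = nat \<lceil>20 * log 2 (real (card (verts G)))\<rceil>"

text \<open>
  An outcome assigns to every edge the pair of its sampling bit and its layer number;
  outside the edge set it has the dummy value \<open>(False, 0)\<close>.
\<close>

definition layered_sampling ::
    "real \<Rightarrow> ('v, 'e) multigraph \<Rightarrow> ('e \<Rightarrow> bool \<times> nat) pmf" where
  "layered_sampling \<epsilon> G = Pi_pmf (edges G) (False, 0)
     (\<lambda>_. pair_pmf (bernoulli_pmf (sampling_prob \<epsilon> G)) (pmf_of_set {1..num_layers G}))"

definition layer :: "('v, 'e) multigraph \<Rightarrow> ('e \<Rightarrow> bool \<times> nat) \<Rightarrow> nat \<Rightarrow> 'e set" where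
  "layer G \<omega> i = {e \<in> edges G. fst (\<omega> e) \<and> snd (\<omega> e) = i}"

definition layered_subgraph ::
    "('v, 'e) multigraph \<Rightarrow> ('e \<Rightarrow> bool \<times> nat) \<Rightarrow> nat \<Rightarrow> ('v, 'e) multigraph" where
  "layered_subgraph G \<omega> i = G\<lparr>edges := (\<Union>j\<in>{1..i}. layer G \<omega> j)\<rparr>"

text \<open>
  If the subgraph for some \<open>i\<close> is connected, the family below contains the pair
  \<open>(verts G, {})\<close>, which is not a cut and hence never a \<^const>\<open>minimum_cut\<close>.
\<close>

definition component_cuts ::
    "('v, 'e) multigraph \<Rightarrow> ('e \<Rightarrow> bool \<times> nat) \<Rightarrow> ('v set \<times> 'v set) set" where
  "component_cuts G \<omega> =
     {(C, verts G - C) | C i. i \<in> {1..num_layers G - 1} \<and> C \<in> components (layered_subgraph G \<omega> i)}"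

end

theory Submission
  imports Defs
begin

text \<open>
  Suppose that no component cut of the graphs built so far is \<open>O(1/\<epsilon>)\<close>-minimum. Then each
  component has \<open>\<Omega>(\<lambda>/\<epsilon>)\<close> boundary edges, all of them still unsampled, and the next layer samples
  each with probability at least \<open>p/L = \<Omega>(\<epsilon>/\<lambda>)\<close>. So a given component survives the layer unchanged
  with small probability, whereas all other components merge in groups of at least two, and the
  expected number of components in excess of one drops by a constant factor. After \<open>L/2\<close> layers
  it is below \<open>n\<^sup>-\<^sup>\<epsilon>/2\<close>, so disconnectedness after \<open>L/2\<close> layers without a small component cut is
  unlikely. On the other hand, a fixed minimum cut receives no edge in these layers with
  probability at least \<open>(1 - p/2)\<^sup>\<lambda> \<ge> n\<^sup>-\<^sup>\<epsilon>\<close>. Stopping at \<open>L/2\<close> keeps the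
  latter estimate valid when \<open>p\<close> is close to \<open>1\<close>.
\<close>

section \<open>Partitions and connected components\<close>

text \<open>A block of \<open>P'\<close> is a union of blocks of \<open>P\<close>. It contains at
  least two of them unless it is itself a block of \<open>P\<close>, so adding the common blocks
  once more gives two per block of \<open>P'\<close>.\<close>

lemma coarser_partition_card:
  assumes fin: "finite V" and P: "partition_on V P" and P': "partition_on V P'"
    and refine: "\<And>C. C \<in> P \<Longrightarrow> \<exists>C'\<in>P'. C \<subseteq> C'"
  shows "2 * card P' \<le> card P + card (P \<inter> P')"
proof -
  define R where "R C' = {C \<in> P. C \<subseteq> C'}" for C'
  have finP: "finite P" and finP': "finite P'"
    using finite_elements fin P P' by blast+
  have fR: "finite (R C')" for C'
    using finP by (simp add: R_def)
  have eqP': "C = D" if "C \<in> P'" "D \<in> P'" "v \<in> C" "v \<in> D" for C D v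
    using partition_onD2[OF P'] that by (auto simp: disjoint_def)
  have cover: "\<exists>C\<in>R C'. v \<in> C" if "C' \<in> P'" "v \<in> C'" for v C'
  proof -
    have "v \<in> V"
      using that partition_onD1[OF P'] by blast
    then obtain C where C: "C \<in> P" "v \<in> C"
      using partition_onD1[OF P] by blast
    then obtain C'' where "C'' \<in> P'" "C \<subseteq> C''"
      using refine by blast
    then show ?thesis
      using C eqP'[OF that(1) _ that(2)] by (auto simp: R_def)
  qed
  have Un: "P = (\<Union>C'\<in>P'. R C')"
    using refine by (auto simp: R_def)
  have disj: "R C \<inter> R D = {}" if "C \<in> P'" "D \<in> P'" "C \<noteq> D" for C D
  proof (rule ccontr)
    assume "R C \<inter> R D \<noteq> {}"
    then obtain B where B: "B \<in> P" "B \<subseteq> C" "B \<subseteq> D"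
      by (auto simp: R_def)
    then obtain v where "v \<in> B"
      using partition_onD3[OF P] by (metis ex_in_conv)
    then show False
      using B eqP' that by blast
  qed
  have lower: "2 \<le> card (R C') + (if C' \<in> P then 1 else 0)" if "C' \<in> P'" for C'
  proof -
    obtain v where "v \<in> C'"
      using partition_onD3[OF P'] \<open>C' \<in> P'\<close> by (metis ex_in_conv)
    then have "R C' \<noteq> {}"
      using cover[OF that] by blast
    then have pos: "card (R C') > 0"
      using fR by (simp add: card_gt_0_iff)
    have "C' \<in> P" if one: "card (R C') = 1"
    proof -
      obtain C where C: "R C' = {C}"
        using one by (auto simp: card_1_singleton_iff)
      then have "C' \<subseteq> C"
        using cover[OF \<open>C' \<in> P'\<close>] by auto
      moreover have "C \<in> P" "C \<subseteq> C'"
        using C by (auto simp: R_def)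
      ultimately show ?thesis
        by auto
    qed
    with pos show ?thesis
      by (cases "card (R C') = 1") auto
  qed
  have "2 * card P' = (\<Sum>C'\<in>P'. 2)"
    by simp
  also have "\<dots> \<le> (\<Sum>C'\<in>P'. card (R C') + (if C' \<in> P then 1 else 0))"
    by (intro sum_mono lower)
  also have "\<dots> = (\<Sum>C'\<in>P'. card (R C')) + card (P \<inter> P')"
    using finP' by (simp add: sum.distrib sum.If_cases Int_def conj_commute)
  also have "(\<Sum>C'\<in>P'. card (R C')) = card P"
    using card_UN_disjoint[OF finP', of R] fR disj unfolding Un[symmetric] by simp
  finally show ?thesis .
qed

lemma sym_adjacency: "sym (adjacency G)"
  by (auto simp: adjacency_def sym_def insert_commute)

lemma partition_on_components: "partition_on (verts G) (components G)"
proof (rule partition_onI)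
  show "\<Union> (components G) = verts G"
    by (auto simp: components_def)
  show "{} \<notin> components G"
    by (auto simp: components_def)
  have s: "sym ((adjacency G)\<^sup>*)"
    by (rule sym_rtrancl[OF sym_adjacency])
  fix C D assume CD: "C \<in> components G" "D \<in> components G" "C \<noteq> D"
  then obtain u w where C: "C = {v \<in> verts G. (u, v) \<in> (adjacency G)\<^sup>*}"
    and D: "D = {v \<in> verts G. (w, v) \<in> (adjacency G)\<^sup>*}"
    by (auto simp: components_def)
  show "disjnt C D"
  proof (rule ccontr)
    assume "\<not> disjnt C D"
    then obtain v where "(u, v) \<in> (adjacency G)\<^sup>*" "(w, v) \<in> (adjacency G)\<^sup>*"
      by (auto simp: disjnt_def C D)
    then have uw: "(u, w) \<in> (adjacency G)\<^sup>*"
      using symD[OF s] rtrancl_trans by fast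
    then have "(u, x) \<in> (adjacency G)\<^sup>* \<longleftrightarrow> (w, x) \<in> (adjacency G)\<^sup>*" for x
      using symD[OF s uw] rtrancl_trans by fast
    then have "C = D"
      unfolding C D by simp
    then show False
      using CD by simp
  qed
qed

lemma component_subset_verts: "C \<in> components G \<Longrightarrow> C \<subseteq> verts G"
  by (auto simp: components_def)

lemma finite_components: "finite (verts G) \<Longrightarrow> finite (components G)"
  by (rule finite_elements[OF _ partition_on_components])

lemma card_components_le: "finite (verts G) \<Longrightarrow> card (components G) \<le> card (verts G)"
  unfolding components_def Setcompr_eq_image by (rule card_image_le)

lemma card_components_pos:
  assumes "finite (verts G)" "verts G \<noteq> {}"
  shows "card (components G) \<ge> 1"
proof -
  have "components G \<noteq> {}"
    using assms(2) by (auto simp: components_def)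
  then show ?thesis
    using finite_components[OF assms(1)] by (simp add: Suc_le_eq card_gt_0_iff)
qed

lemma components_mono:
  assumes "adjacency G \<subseteq> adjacency H" "verts G = verts H" "C \<in> components G"
  shows "\<exists>C'\<in>components H. C \<subseteq> C'"
proof -
  obtain u where u: "u \<in> verts G" "C = {v \<in> verts G. (u, v) \<in> (adjacency G)\<^sup>*}"
    using assms(3) by (auto simp: components_def)
  then have "C \<subseteq> {v \<in> verts H. (u, v) \<in> (adjacency H)\<^sup>*}"
    using assms(2) rtrancl_mono[OF assms(1)] by auto
  moreover have "{v \<in> verts H. (u, v) \<in> (adjacency H)\<^sup>*} \<in> components H"
    using u(1) assms(2) by (auto simp: components_def)
  ultimately show ?thesis ..
qed

lemma component_no_crossing_edge:
  assumes "C \<in> components G" "e \<in> edges G" "ends G e \<subseteq> verts G" "card (ends G e) \<in> {1, 2}"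
  shows "\<not> (ends G e \<inter> C \<noteq> {} \<and> ends G e \<inter> (verts G - C) \<noteq> {})"
proof
  assume "ends G e \<inter> C \<noteq> {} \<and> ends G e \<inter> (verts G - C) \<noteq> {}"
  then obtain a b where ab: "a \<in> ends G e" "a \<in> C" "b \<in> ends G e" "b \<in> verts G" "b \<notin> C"
    by blast
  then have "ends G e = {a, b}"
    using assms(4) by (auto simp: card_1_singleton_iff card_2_iff)
  then have edge: "(a, b) \<in> adjacency G"
    using assms(2) by (auto simp: adjacency_def)
  obtain u where C: "C = {v \<in> verts G. (u, v) \<in> (adjacency G)\<^sup>*}"
    using assms(1) by (auto simp: components_def)
  have "(u, b) \<in> (adjacency G)\<^sup>*"
    using ab(2) rtrancl_into_rtrancl[OF _ edge] by (simp add: C)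
  then show False
    using ab by (simp add: C)
qed

text \<open>A set that no edge leaves is closed under adjacency. A single component would provide a
  path from \<open>C\<close> to its complement.\<close>

lemma card_components_ge_2:
  assumes fin: "finite (verts G)" and C: "C \<noteq> {}" "C \<subset> verts G"
    and no: "\<And>e. e \<in> edges G \<Longrightarrow> \<not> (ends G e \<inter> C \<noteq> {} \<and> ends G e \<inter> (verts G - C) \<noteq> {})"
    and ends: "\<And>e. e \<in> edges G \<Longrightarrow> ends G e \<subseteq> verts G"
  shows "card (components G) \<ge> 2"
proof (rule ccontr)
  assume "\<not> ?thesis"
  then have "card (components G) = 1"
    using card_components_pos[OF fin] C by fastforce
  then obtain K where K: "components G = {K}"
    by (auto simp: card_1_singleton_iff)
  then have "K = verts G"
    using partition_onD1[OF partition_on_components, of G] by simp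
  obtain a b where ab: "a \<in> C" "b \<in> verts G" "b \<notin> C"
    using C by blast
  have "{v \<in> verts G. (a, v) \<in> (adjacency G)\<^sup>*} \<in> components G"
    using ab C by (auto simp: components_def)
  then have path: "(a, b) \<in> (adjacency G)\<^sup>*"
    using K \<open>K = verts G\<close> ab by auto
  have "v \<in> C" if "(a, v) \<in> (adjacency G)\<^sup>*" for v
    using that
  proof (induction rule: rtrancl_induct)
    case (step y z)
    then obtain e where "e \<in> edges G" "ends G e = {y, z}"
      by (auto simp: adjacency_def)
    then show ?case
      using no[of e] ends[of e] step.IH by auto
  qed (use ab in simp)
  then show False
    using path ab by blast
qed

lemma component_is_cut:
  assumes "card (components G) \<ge> 2" "C \<in> components G"
  shows "C \<noteq> {}" "C \<subset> verts G"
proof -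
  show "C \<noteq> {}"
    using assms(2) partition_onD3[OF partition_on_components] by blast
  have "components G \<noteq> {C}"
    using assms(1) by auto
  then obtain D where D: "D \<in> components G" "D \<noteq> C"
    using assms(2) by blast
  then have "D \<inter> C = {}" "D \<noteq> {}" "D \<subseteq> verts G"
    using assms(2) partition_on_components[of G] component_subset_verts
    by (auto simp: partition_on_def disjoint_def)
  then show "C \<subset> verts G"
    using component_subset_verts[OF assms(2)] by blast
qed

section \<open>Product distributions and indicator sums\<close>

lemma measure_pair_pmf_Times:
  "measure_pmf.prob (pair_pmf M N) (A \<times> B) = measure_pmf.prob M A * measure_pmf.prob N B"
proof -
  \<comment> \<open>Intersecting with the supports makes both factors countable, as
    \<open>measure_pmf_prob_product\<close> demands.\<close>
  have "measure_pmf.prob (pair_pmf M N) (A \<times> B) =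
      measure_pmf.prob (pair_pmf M N) ((A \<inter> set_pmf M) \<times> (B \<inter> set_pmf N))"
    by (subst (1 2) measure_Int_set_pmf[symmetric]) (auto intro!: arg_cong[where f = "measure _"])
  also have "\<dots> = measure_pmf.prob M (A \<inter> set_pmf M) * measure_pmf.prob N (B \<inter> set_pmf N)"
    by (intro measure_pmf_prob_product) auto
  finally show ?thesis
    by (simp add: measure_Int_set_pmf)
qed

text \<open>
  The exchange condition says that \<open>E\<close> is the product of the event \<open>\<omega> ` F \<subseteq> Q\<close> and an event on
  the coordinates outside \<open>F\<close>. This replaces conditioning on the history of the experiment.
\<close>

lemma prob_Pi_pmf_restrict_block:
  assumes fin: "finite A" and F: "F \<subseteq> A" and "R \<subseteq> Q"
    and E: "\<And>\<omega> e. \<omega> \<in> E \<Longrightarrow> e \<in> F \<Longrightarrow> \<omega> e \<in> Q"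
    and exchange: "\<And>\<omega> \<omega>'. \<omega> \<in> E \<Longrightarrow> (\<And>e. e \<notin> F \<Longrightarrow> \<omega>' e = \<omega> e) \<Longrightarrow>
      (\<And>e. e \<in> F \<Longrightarrow> \<omega>' e \<in> Q) \<Longrightarrow> \<omega>' \<in> E"
    and r: "measure_pmf.prob D R \<le> r * measure_pmf.prob D Q"
  shows "measure_pmf.prob (Pi_pmf A d (\<lambda>_. D)) (E \<inter> {\<omega>. \<forall>e\<in>F. \<omega> e \<in> R})
    \<le> r ^ card F * measure_pmf.prob (Pi_pmf A d (\<lambda>_. D)) E"
proof -
  let ?h = "\<lambda>(f, g) x. if x \<in> F then f x else g x"
  let ?PF = "Pi_pmf F d (\<lambda>_. D)" and ?PA = "Pi_pmf (A - F) d (\<lambda>_. D)"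
  have finF: "finite F"
    using fin F finite_subset by blast
  have "Pi_pmf (F \<union> (A - F)) d (\<lambda>_. D) = map_pmf ?h (pair_pmf ?PF ?PA)"
    by (rule Pi_pmf_union) (use fin finF in auto)
  then have split: "Pi_pmf A d (\<lambda>_. D) = map_pmf ?h (pair_pmf ?PF ?PA)"
    using F by (simp add: Un_absorb1)
  \<comment> \<open>\<open>E'\<close> is \<open>E\<close> with the coordinates in \<open>F\<close>
    forgotten. By \<open>mem\<close>, the preimages of both events under \<open>?h\<close> are
    rectangles with the same second factor, so only the powers for \<open>R\<close> and
    \<open>Q\<close> have to be compared.\<close>
  define E' where "E' = {g. \<exists>\<omega>\<in>E. \<forall>e. e \<notin> F \<longrightarrow> \<omega> e = g e}"
  have mem: "?h (f, g) \<in> E \<longleftrightarrow> (\<forall>e\<in>F. f e \<in> Q) \<and> g \<in> E'" for f g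
  proof
    assume h: "?h (f, g) \<in> E"
    have "\<forall>e\<in>F. f e \<in> Q"
    proof
      fix e assume "e \<in> F"
      then show "f e \<in> Q"
        using E[OF h, of e] by simp
    qed
    moreover have "g \<in> E'"
      unfolding E'_def by (rule CollectI, rule bexI[OF _ h]) simp
    ultimately show "(\<forall>e\<in>F. f e \<in> Q) \<and> g \<in> E'" ..
  next
    assume fg: "(\<forall>e\<in>F. f e \<in> Q) \<and> g \<in> E'"
    then obtain \<omega> where "\<omega> \<in> E" "\<forall>e. e \<notin> F \<longrightarrow> \<omega> e = g e"
      by (auto simp: E'_def)
    then show "?h (f, g) \<in> E"
      using fg by (intro exchange[OF \<open>\<omega> \<in> E\<close>]) auto
  qed
  have pre: "?h -` E = Pi F (\<lambda>_. Q) \<times> E'"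
    using mem by (auto simp: Pi_def)
  have pre': "?h -` (E \<inter> {\<omega>. \<forall>e\<in>F. \<omega> e \<in> R}) = Pi F (\<lambda>_. R) \<times> E'"
    using mem subsetD[OF \<open>R \<subseteq> Q\<close>] by (auto simp: Pi_def)
  have "measure_pmf.prob D R ^ card F \<le> (r * measure_pmf.prob D Q) ^ card F"
    by (intro power_mono r) simp
  then have "measure_pmf.prob D R ^ card F * measure_pmf.prob ?PA E'
      \<le> (r * measure_pmf.prob D Q) ^ card F * measure_pmf.prob ?PA E'"
    by (intro mult_right_mono) auto
  then show ?thesis
    unfolding split measure_map_pmf pre pre' measure_pair_pmf_Times
    by (simp add: measure_Pi_pmf_Pi finF power_mult_distrib mult_ac)
qed


lemma sum_indicat_real: "finite A \<Longrightarrow> (\<Sum>x\<in>A. indicat_real B x) = real (card (A \<inter> B))"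
  by (simp add: indicator_def)

section \<open>Graphs formed by the first layers\<close>

text \<open>These are the values of a single coordinate that put an edge into the graph of the first
  \<open>i\<close> layers. Events about graphs thereby become events about independent
  coordinates.\<close>

definition sampled_by :: "nat \<Rightarrow> (bool \<times> nat) set" where
  "sampled_by i = {True} \<times> {1..i}"

lemma verts_layered_subgraph [simp]: "verts (layered_subgraph G \<omega> i) = verts G"
  and ends_layered_subgraph [simp]: "ends (layered_subgraph G \<omega> i) = ends G"
  by (simp_all add: layered_subgraph_def)

lemma edges_layered_subgraph:
  "edges (layered_subgraph G \<omega> i) = {e \<in> edges G. \<omega> e \<in> sampled_by i}"
  by (auto simp: layered_subgraph_def layer_def sampled_by_def mem_Times_iff)

text \<open>In this form, outcomes that agree on membership in \<open>sampled_by i\<close> visibly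
  give equal graphs.\<close>

lemma layered_subgraph_eq:
  "layered_subgraph G \<omega> i = G\<lparr>edges := {e \<in> edges G. \<omega> e \<in> sampled_by i}\<rparr>"
  using edges_layered_subgraph[of G \<omega> i] by (simp add: layered_subgraph_def)

lemma sampled_by_mono: "i \<le> j \<Longrightarrow> sampled_by i \<subseteq> sampled_by j"
  by (auto simp: sampled_by_def)

lemma adjacency_layered_subgraph_mono:
  "i \<le> j \<Longrightarrow> adjacency (layered_subgraph G \<omega> i) \<subseteq> adjacency (layered_subgraph G \<omega> j)"
  using sampled_by_mono[of i j] by (auto simp: adjacency_def edges_layered_subgraph)

section \<open>Parameters and the distribution of a single edge\<close>

locale layered_cut_sampling =
  fixes G :: "('v, 'e) multigraph" and \<epsilon> :: real
  assumes fin_graph: "finite_multigraph G"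
    and two_verts: "card (verts G) \<ge> 2"
    and conn_pos: "edge_connectivity G > 0"
    and eps_pos: "0 < \<epsilon>"
    and p_le_1: "sampling_prob \<epsilon> G \<le> 1"
begin

abbreviation "n \<equiv> real (card (verts G))"
abbreviation "lam \<equiv> edge_connectivity G"
abbreviation "p \<equiv> sampling_prob \<epsilon> G"
abbreviation "L \<equiv> num_layers G"
abbreviation "P \<equiv> layered_sampling \<epsilon> G"
abbreviation "D \<equiv> pair_pmf (bernoulli_pmf p) (pmf_of_set {1..L})"
abbreviation "comps \<omega> i \<equiv> components (layered_subgraph G \<omega> i)"

lemma fin_verts: "finite (verts G)" and fin_edges: "finite (edges G)"
  and ends_edge: "e \<in> edges G \<Longrightarrow> ends G e \<subseteq> verts G \<and> card (ends G e) \<in> {1, 2}"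
  using fin_graph by (auto simp: finite_multigraph_def)

lemma log_n_ge_1: "log 2 n \<ge> 1"
  using two_verts by (simp add: le_log_iff)

lemma p_pos: "0 < p"
  using log_n_ge_1 eps_pos conn_pos by (simp add: sampling_prob_def)

lemma p_times_conn: "p * real lam = \<epsilon> * log 2 n / 2"
  using conn_pos by (simp add: sampling_prob_def)

text \<open>Rounding up adds less than 1, and \<open>log 2 n\<close> is at least 1, so the factor 20
  grows to at most 21.\<close>

lemma L_bounds: "20 * log 2 n \<le> real L" "real L \<le> 21 * log 2 n" "L \<ge> 20"
proof -
  have L: "real L = of_int \<lceil>20 * log 2 n\<rceil>"
    using log_n_ge_1 by (simp add: num_layers_def)
  show "20 * log 2 n \<le> real L"
    unfolding L by linarith
  show "real L \<le> 21 * log 2 n"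
    unfolding L using log_n_ge_1 by linarith
  show "L \<ge> 20"
    using \<open>20 * log 2 n \<le> real L\<close> log_n_ge_1 by linarith
qed

lemma prob_unsampled:
  assumes "i \<le> L"
  shows "measure_pmf.prob D (- sampled_by i) = 1 - p * real i / real L"
proof -
  have "measure_pmf.prob D (sampled_by i) = p * (real i / real L)"
    unfolding sampled_by_def measure_pair_pmf_Times using assms L_bounds(3) p_pos p_le_1
    by (simp add: measure_pmf_single measure_pmf_of_set Int_absorb1)
  then show ?thesis
    using measure_pmf.prob_compl[of "sampled_by i" D] by (simp add: Compl_eq_Diff_UNIV)
qed

text \<open>Knowing that the first \<open>i\<close> layers missed an edge only raises the chance
  that the next one takes it: the product on the right exceeds the left side by
  \<open>p\<^sup>2 * i / L\<^sup>2\<close>.\<close>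

lemma prob_unsampled_step:
  assumes "i < L"
  shows "measure_pmf.prob D (- sampled_by (Suc i))
    \<le> (1 - p / real L) * measure_pmf.prob D (- sampled_by i)"
proof -
  have "0 \<le> (p / real L) * (p / real L * real i)"
    using p_pos by (intro mult_nonneg_nonneg) auto
  moreover have "(1 - p / real L) * (1 - p * real i / real L)
      = 1 - p * real (Suc i) / real L + (p / real L) * (p / real L * real i)"
    using assms by (simp add: field_simps)
  moreover have "i \<le> L" "Suc i \<le> L"
    using assms by auto
  ultimately show ?thesis
    unfolding prob_unsampled[OF \<open>i \<le> L\<close>] prob_unsampled[OF \<open>Suc i \<le> L\<close>]
    by linarith
qed

text \<open>This makes every real function integrable, which settles all integrability conditions
  below.\<close>

lemma finite_support: "finite (set_pmf P)"
proof -
  have "finite (set_pmf D)"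
    using L_bounds(3) by (simp add: set_pmf_of_set)
  then show ?thesis
    unfolding layered_sampling_def set_Pi_pmf[OF fin_edges]
    by (intro finite_PiE_dflt fin_edges) simp
qed

lemma integrable_P [simp]: "integrable (measure_pmf P) (f :: _ \<Rightarrow> real)"
  by (rule integrable_measure_pmf_finite[OF finite_support])

section \<open>Geometric decay of the expected number of excess components\<close>

text \<open>The constant is 126 = 2 * 3 * 21: since \<open>p * lam\<close> is
  \<open>\<epsilon> * log 2 n / 2\<close>, it gives \<open>p * m\<close> at least
  \<open>63 * log 2 n\<close>, hence at least \<open>3 * L\<close>. So at least 3 hits are expected,
  and \<open>exp (- 3)\<close> is below 1/6 because e is at least 2.\<close>

lemma large_cut_unhit:
  assumes "126 / \<epsilon> * real lam < real m"
  shows "(1 - p / real L) ^ m \<le> 1 / 6"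
proof -
  have L0: "real L > 0"
    using L_bounds(3) by simp
  have "63 * log 2 n = p * (126 / \<epsilon> * real lam)"
    using p_times_conn eps_pos by (simp add: field_simps)
  also have "\<dots> \<le> p * real m"
    using assms p_pos by (intro mult_left_mono) auto
  finally have "3 * real L \<le> p * real m"
    using L_bounds(2) by linarith
  then have ge3: "3 \<le> real m * (p / real L)"
    using L0 by (simp add: field_simps)
  have "p / real L \<le> 1"
    using L_bounds(3) p_le_1 by (simp add: field_simps)
  then have "(1 - p / real L) ^ m \<le> exp (- (p / real L)) ^ m"
    using exp_ge_add_one_self[of "- (p / real L)"] by (intro power_mono) auto
  also have "\<dots> = exp (- (real m * (p / real L)))"
    by (simp flip: exp_of_nat_mult)
  also have "\<dots> \<le> exp (- 3)"
    using ge3 by simp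
  also have "\<dots> \<le> 1 / 6"
  proof -
    have "(2::real) ^ 3 \<le> exp 1 ^ 3"
      using exp_ge_add_one_self[of 1] by (intro power_mono) auto
    then have "8 \<le> exp (3::real)"
      by (simp flip: exp_of_nat_mult)
    then show ?thesis
      by (simp add: exp_minus field_simps)
  qed
  finally show ?thesis .
qed

text \<open>The guard on the number of components excludes connected graphs, whose only component
  has an empty boundary without being a cut. Layer 0 is left out because
  \<open>component_cuts\<close> starts at layer 1.\<close>

definition no_small_before :: "('e \<Rightarrow> bool \<times> nat) \<Rightarrow> nat \<Rightarrow> bool" where
  "no_small_before \<omega> i \<longleftrightarrow> (\<forall>j\<in>{1..<i}. card (comps \<omega> j) \<ge> 2 \<longrightarrow>
     (\<forall>C\<in>comps \<omega> j. 126 / \<epsilon> * real lam < real (cut_size G (C, verts G - C))))"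

text \<open>The value 0 after a small cut discards the outcomes that have already succeeded. On the
  others, being disconnected means a value of at least 1, which suits Markov's inequality.\<close>

definition surplus :: "nat \<Rightarrow> ('e \<Rightarrow> bool \<times> nat) \<Rightarrow> real" where
  "surplus i \<omega> = (if no_small_before \<omega> i then real (card (comps \<omega> i)) - 1 else 0)"

lemma card_comps: "1 \<le> card (comps \<omega> i)" "card (comps \<omega> i) \<le> card (verts G)"
  using card_components_pos[of "layered_subgraph G \<omega> i"] card_components_le[of "layered_subgraph G \<omega> i"]
    fin_verts two_verts card.empty by fastforce+

lemma surplus_nonneg: "surplus i \<omega> \<ge> 0"
  using card_comps(1)[of \<omega> i] by (simp add: surplus_def)

text \<open>With \<open>Suc i\<close>, the cuts of layer \<open>i\<close> itself are large too,
  including that of \<open>C\<close>. Fixing \<open>C\<close> makes its boundary a deterministic set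
  of edges, while the event still depends only on the first \<open>i\<close> layers.\<close>

definition stuck_at :: "nat \<Rightarrow> 'v set \<Rightarrow> ('e \<Rightarrow> bool \<times> nat) set" where
  "stuck_at i C = {\<omega>. no_small_before \<omega> (Suc i) \<and> card (comps \<omega> i) \<ge> 2 \<and> C \<in> comps \<omega> i}"

lemma comps_no_crossing:
  assumes "C \<in> comps \<omega> i" "e \<in> cut_edges G (C, verts G - C)"
  shows "\<omega> e \<in> - sampled_by i"
proof
  assume "\<omega> e \<in> sampled_by i"
  then have "e \<in> edges (layered_subgraph G \<omega> i)"
    using assms(2) by (simp add: edges_layered_subgraph cut_edges_def)
  then show False
    using component_no_crossing_edge[OF assms(1), of e] ends_edge[of e] assms(2)
    by (auto simp: cut_edges_def)
qed

text \<open>Survival of \<open>C\<close> forces all its boundary edges to be missed by layer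
  \<open>i + 1\<close> as well. They are known only to have been missed so far, so each contributes
  an independent factor of at most \<open>1 - p / L\<close>.\<close>

lemma prob_component_survives:
  assumes i: "1 \<le> i" "i < L"
  shows "measure_pmf.prob P (stuck_at i C \<inter> {\<omega>. C \<in> comps \<omega> (Suc i)})
    \<le> 1 / 6 * measure_pmf.prob P (stuck_at i C)"
proof (cases "stuck_at i C = {}")
  case False
  \<comment> \<open>The size of the cut does not depend on the outcome, so one witness shows that it
    is large.\<close>
  then obtain \<omega>0 where "\<omega>0 \<in> stuck_at i C"
    by blast
  let ?F = "cut_edges G (C, verts G - C)"
  have large: "126 / \<epsilon> * real lam < real (card ?F)"
    using \<open>\<omega>0 \<in> stuck_at i C\<close> i by (auto simp: stuck_at_def no_small_before_def cut_size_def)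
  have "measure_pmf.prob P (stuck_at i C \<inter> {\<omega>. C \<in> comps \<omega> (Suc i)})
      \<le> measure_pmf.prob P (stuck_at i C \<inter> {\<omega>. \<forall>e\<in>?F. \<omega> e \<in> - sampled_by (Suc i)})"
    using comps_no_crossing[of C _ "Suc i"] by (intro measure_pmf.finite_measure_mono) auto
  also have "\<dots> \<le> (1 - p / real L) ^ card ?F * measure_pmf.prob P (stuck_at i C)"
    unfolding layered_sampling_def
  proof (rule prob_Pi_pmf_restrict_block[OF fin_edges, where Q = "- sampled_by i"])
    show "?F \<subseteq> edges G"
      by (auto simp: cut_edges_def)
    show "- sampled_by (Suc i) \<subseteq> - sampled_by i"
      using sampled_by_mono[of i "Suc i"] by auto
    show "measure_pmf.prob D (- sampled_by (Suc i))
        \<le> (1 - p / real L) * measure_pmf.prob D (- sampled_by i)"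
      by (rule prob_unsampled_step[OF i(2)])
    show out: "\<omega> e \<in> - sampled_by i" if "\<omega> \<in> stuck_at i C" "e \<in> ?F" for \<omega> e
      using that comps_no_crossing[of C \<omega> i e] by (simp add: stuck_at_def)
    \<comment> \<open>Changing boundary edges within \<open>- sampled_by i\<close> alters none of
      the graphs up to layer \<open>i\<close>, and these determine the event.\<close>
    show "\<omega>' \<in> stuck_at i C"
      if \<omega>: "\<omega> \<in> stuck_at i C" and same: "\<And>e. e \<notin> ?F \<Longrightarrow> \<omega>' e = \<omega> e"
        and out': "\<And>e. e \<in> ?F \<Longrightarrow> \<omega>' e \<in> - sampled_by i" for \<omega> \<omega>'
    proof -
      have "\<omega>' e \<in> sampled_by j \<longleftrightarrow> \<omega> e \<in> sampled_by j" if "j \<le> i" for e j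
        using same[of e] out'[of e] out[OF \<omega>, of e] sampled_by_mono[OF that] by (cases "e \<in> ?F") auto
      then have eq: "layered_subgraph G \<omega>' j = layered_subgraph G \<omega> j" if "j \<le> i" for j
        using that by (simp add: layered_subgraph_eq)
      then show ?thesis
        using \<omega> by (simp add: stuck_at_def no_small_before_def)
    qed
  qed
  also have "\<dots> \<le> 1 / 6 * measure_pmf.prob P (stuck_at i C)"
    by (intro mult_right_mono large_cut_unhit large) simp
  finally show ?thesis .
qed simp

lemma stuck_subset_verts: "\<omega> \<in> stuck_at i C \<Longrightarrow> C \<in> Pow (verts G)"
  using component_subset_verts[of C "layered_subgraph G \<omega> i"] by (simp add: stuck_at_def)

text \<open>This is \<open>coarser_partition_card\<close> for consecutive layers, where the sum
  counts the surviving components. Summing over all vertex sets keeps the index set independent of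
  the outcome, so that expectations can be taken termwise.\<close>

lemma surplus_Suc:
  "surplus (Suc i) \<omega> \<le> surplus i \<omega> / 2
     + (\<Sum>C\<in>Pow (verts G). indicat_real (stuck_at i C \<inter> {\<omega>. C \<in> comps \<omega> (Suc i)}) \<omega>) / 2"
proof (cases "no_small_before \<omega> (Suc i)")
  case True
  then have before: "no_small_before \<omega> i"
    by (auto simp: no_small_before_def)
  have merge: "2 * card (comps \<omega> (Suc i)) \<le> card (comps \<omega> i) + card (comps \<omega> i \<inter> comps \<omega> (Suc i))"
  proof (rule coarser_partition_card[OF fin_verts])
    show "partition_on (verts G) (comps \<omega> i)" "partition_on (verts G) (comps \<omega> (Suc i))"
      using partition_on_components[of "layered_subgraph G \<omega> _"] by simp_all
    show "\<exists>C'\<in>comps \<omega> (Suc i). C \<subseteq> C'" if "C \<in> comps \<omega> i" for C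
      using components_mono[OF adjacency_layered_subgraph_mono[of i "Suc i"] _ that] by simp
  qed
  show ?thesis
  proof (cases "card (comps \<omega> i) \<ge> 2")
    case two: True
    have "(\<Sum>C\<in>Pow (verts G). indicat_real (stuck_at i C \<inter> {\<omega>. C \<in> comps \<omega> (Suc i)}) \<omega>)
        = (\<Sum>C\<in>Pow (verts G). indicat_real (comps \<omega> i \<inter> comps \<omega> (Suc i)) C)"
      using True two by (intro sum.cong) (auto simp: stuck_at_def indicator_def)
    also have "\<dots> = real (card (Pow (verts G) \<inter> (comps \<omega> i \<inter> comps \<omega> (Suc i))))"
      using fin_verts by (intro sum_indicat_real) simp
    also have "Pow (verts G) \<inter> (comps \<omega> i \<inter> comps \<omega> (Suc i)) = comps \<omega> i \<inter> comps \<omega> (Suc i)"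
      using component_subset_verts[of _ "layered_subgraph G \<omega> i"] by auto
    finally show ?thesis
      using merge True before by (simp add: surplus_def field_simps)
  next
    case False
    have "card (comps \<omega> i \<inter> comps \<omega> (Suc i)) \<le> card (comps \<omega> i)"
      using finite_components[of "layered_subgraph G \<omega> i"] fin_verts by (intro card_mono) auto
    then have "card (comps \<omega> (Suc i)) \<le> 1"
      using merge False by linarith
    then have "surplus (Suc i) \<omega> \<le> 0"
      by (simp add: surplus_def)
    also have "0 \<le> surplus i \<omega> / 2 + (\<Sum>C\<in>Pow (verts G).
        indicat_real (stuck_at i C \<inter> {\<omega>. C \<in> comps \<omega> (Suc i)}) \<omega>) / 2"
      using surplus_nonneg[of i \<omega>] by (intro add_nonneg_nonneg divide_nonneg_nonneg sum_nonneg) auto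
    finally show ?thesis .
  qed
next
  case False
  then have "surplus (Suc i) \<omega> \<le> 0"
    by (simp add: surplus_def)
  also have "0 \<le> surplus i \<omega> / 2 + (\<Sum>C\<in>Pow (verts G).
      indicat_real (stuck_at i C \<inter> {\<omega>. C \<in> comps \<omega> (Suc i)}) \<omega>) / 2"
    using surplus_nonneg[of i \<omega>] by (intro add_nonneg_nonneg divide_nonneg_nonneg sum_nonneg) auto
  finally show ?thesis .
qed

text \<open>The sum is either 0 or the number k of components, and k is at most 2 * (k - 1) once k
  is at least 2.\<close>

lemma sum_stuck_le: "(\<Sum>C\<in>Pow (verts G). indicat_real (stuck_at i C) \<omega>) \<le> 2 * surplus i \<omega>"
proof (cases "no_small_before \<omega> (Suc i) \<and> card (comps \<omega> i) \<ge> 2")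
  case True
  then have before: "no_small_before \<omega> i"
    by (auto simp: no_small_before_def)
  have "(\<Sum>C\<in>Pow (verts G). indicat_real (stuck_at i C) \<omega>)
      = (\<Sum>C\<in>Pow (verts G). indicat_real (comps \<omega> i) C)"
    using True by (intro sum.cong) (auto simp: stuck_at_def indicator_def)
  also have "\<dots> = real (card (Pow (verts G) \<inter> comps \<omega> i))"
    using fin_verts by (intro sum_indicat_real) simp
  also have "Pow (verts G) \<inter> comps \<omega> i = comps \<omega> i"
    using component_subset_verts[of _ "layered_subgraph G \<omega> i"] by auto
  finally show ?thesis
    using True before by (simp add: surplus_def)
next
  case False
  then have "(\<Sum>C\<in>Pow (verts G). indicat_real (stuck_at i C) \<omega>) = 0"
    by (intro sum.neutral) (auto simp: stuck_at_def)
  then show ?thesis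
    using surplus_nonneg[of i \<omega>] by simp
qed

text \<open>Half of the surplus remains after merging, and survivors add at most 1/2 * 1/6 * 2 = 1/6
  of it, for a total factor of 2/3.\<close>

lemma expectation_surplus_step:
  assumes "1 \<le> i" "i < L"
  shows "measure_pmf.expectation P (surplus (Suc i)) \<le> 2 / 3 * measure_pmf.expectation P (surplus i)"
proof -
  let ?E = "measure_pmf.expectation P"
  let ?S = "\<lambda>C. stuck_at i C \<inter> {\<omega>. C \<in> comps \<omega> (Suc i)}"
  have "?E (surplus (Suc i)) \<le> ?E (\<lambda>\<omega>. surplus i \<omega> / 2
      + (\<Sum>C\<in>Pow (verts G). indicat_real (?S C) \<omega>) / 2)"
    by (intro integral_mono surplus_Suc) simp_all
  also have "\<dots> = ?E (surplus i) / 2 + (\<Sum>C\<in>Pow (verts G). measure_pmf.prob P (?S C)) / 2"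
    by (simp add: Bochner_Integration.integral_add Bochner_Integration.integral_sum)
  also have "\<dots> \<le> ?E (surplus i) / 2 + (\<Sum>C\<in>Pow (verts G). 1 / 6 * measure_pmf.prob P (stuck_at i C)) / 2"
    by (intro add_left_mono divide_right_mono sum_mono prob_component_survives assms) simp
  also have "(\<Sum>C\<in>Pow (verts G). 1 / 6 * measure_pmf.prob P (stuck_at i C))
      = 1 / 6 * ?E (\<lambda>\<omega>. \<Sum>C\<in>Pow (verts G). indicat_real (stuck_at i C) \<omega>)"
    by (simp add: Bochner_Integration.integral_sum sum_distrib_left)
  also have "?E (\<lambda>\<omega>. \<Sum>C\<in>Pow (verts G). indicat_real (stuck_at i C) \<omega>) \<le> ?E (\<lambda>\<omega>. 2 * surplus i \<omega>)"
    by (intro integral_mono sum_stuck_le) simp_all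
  finally show ?thesis
    by simp
qed

text \<open>The decay starts from layer 1, where the surplus is at most \<open>n\<close>; hence the
  exponent is one less than the layer.\<close>

lemma expectation_surplus_le:
  assumes "m < L"
  shows "measure_pmf.expectation P (surplus (Suc m)) \<le> n * (2 / 3) ^ m"
  using assms
proof (induction m)
  case 0
  have "surplus (Suc 0) \<omega> \<le> n" for \<omega>
  proof -
    have "real (card (comps \<omega> (Suc 0))) \<le> n"
      using card_comps(2) by simp
    then show ?thesis
      by (simp add: surplus_def)
  qed
  then have "measure_pmf.expectation P (surplus (Suc 0)) \<le> measure_pmf.expectation P (\<lambda>_. n)"
    by (intro integral_mono) simp_all
  then show ?case
    by simp
next
  case (Suc m)
  then show ?case
    using expectation_surplus_step[of "Suc m"] by simp
qed

section \<open>Survival of a minimum cut\<close>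

text \<open>The first \<open>M\<close> layers miss each of the \<open>lam\<close> edges of a fixed
  minimum cut independently with probability \<open>1 - x\<close>. As \<open>x\<close> is at most
  1/2, this is at least \<open>exp (- 2 * x)\<close>.\<close>

lemma prob_disconnected:
  assumes "2 * M \<le> L"
  shows "n powr (- \<epsilon>) \<le> measure_pmf.prob P {\<omega>. card (comps \<omega> M) \<ge> 2}"
proof -
  have "finite (cuts G)"
    by (rule finite_subset[of _ "Pow (verts G) \<times> Pow (verts G)"]) (auto simp: cuts_def fin_verts)
  moreover have "cuts G \<noteq> {}"
  proof -
    obtain a b where "a \<in> verts G" "b \<in> verts G" "a \<noteq> b"
      using two_verts by (auto simp: card_le_Suc_iff numeral_2_eq_2)
    then have "({a}, verts G - {a}) \<in> cuts G"
      by (auto simp: cuts_def)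
    then show ?thesis
      by blast
  qed
  ultimately have "lam \<in> cut_size G ` cuts G"
    unfolding edge_connectivity_def by (intro Min_in) auto
  then obtain X where X: "X \<in> cuts G" "cut_size G X = lam"
    by auto
  then obtain C where "X = (C, verts G - C)" "C \<noteq> {}" "C \<subset> verts G"
    by (auto simp: cuts_def)
  with X have C: "C \<noteq> {}" "C \<subset> verts G" "cut_size G (C, verts G - C) = lam"
    by simp_all
  let ?F = "cut_edges G (C, verts G - C)"
  let ?B = "\<lambda>e. if e \<in> ?F then - sampled_by M else UNIV"
  have F: "?F \<subseteq> edges G" "card ?F = lam"
    using C(3) by (auto simp: cut_edges_def cut_size_def)
  define x where "x = p * real M / real L"
  have x: "0 \<le> x" "x \<le> p / 2" "x \<le> 1 / 2"
  proof -
    have L0: "real L > 0"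
      using L_bounds(3) by simp
    show "0 \<le> x"
      using p_pos by (simp add: x_def)
    have "p * (2 * real M) \<le> p * real L"
      using assms p_pos by (intro mult_left_mono) linarith+
    then show "x \<le> p / 2"
      using L0 by (simp add: x_def field_simps)
    then show "x \<le> 1 / 2"
      using p_le_1 by simp
  qed
  \<comment> \<open>The change of base costs nothing because \<open>2 * ln 2\<close> is at least
    1.\<close>
  have "\<epsilon> * log 2 n / 2 \<le> \<epsilon> * ln n"
  proof -
    have "ln n * 1 \<le> ln n * (2 * ln 2)"
      using ln2_ge_two_thirds two_verts by (intro mult_left_mono) auto
    then have "log 2 n / 2 \<le> ln n"
      by (simp add: log_def field_simps)
    then show ?thesis
      using mult_left_mono[of "log 2 n / 2" "ln n" \<epsilon>] eps_pos by simp
  qed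
  moreover have "real lam * (2 * x) \<le> \<epsilon> * log 2 n / 2"
    using mult_left_mono[of "2 * x" p "real lam"] x p_times_conn by (simp add: mult.commute)
  ultimately have "- \<epsilon> * ln n \<le> real lam * (- 2 * x)"
    by simp
  then have "n powr (- \<epsilon>) \<le> exp (- 2 * x) ^ lam"
    using two_verts by (auto simp: powr_def simp flip: exp_of_nat_mult)
  also have "\<dots> \<le> (1 - x) ^ lam"
  proof (intro power_mono)
    \<comment> \<open>The library bound is \<open>- x - 2 * x\<^sup>2\<close>; this absorbs its
      quadratic term into a second \<open>- x\<close>.\<close>
    have "x * x \<le> 1 / 2 * x"
      using x by (intro mult_right_mono)
    then have "- 2 * x \<le> ln (1 - x)"
      using ln_one_minus_pos_lower_bound[OF x(1) x(3)] by (simp add: power2_eq_square)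
    then show "exp (- 2 * x) \<le> 1 - x"
      using x by (simp add: ln_ge_iff)
  qed simp
  also have "(1 - x) ^ lam = (\<Prod>e\<in>edges G. if e \<in> ?F then 1 - x else 1)"
    using F fin_edges by (simp add: prod.If_cases Int_absorb1)
  also have "\<dots> = (\<Prod>e\<in>edges G. measure_pmf.prob D (?B e))"
    using prob_unsampled[of M] assms by (intro prod.cong) (simp_all add: x_def)
  also have "\<dots> = measure_pmf.prob P (Pi (edges G) ?B)"
    unfolding layered_sampling_def by (rule measure_Pi_pmf_Pi[symmetric, OF fin_edges])
  also have "\<dots> \<le> measure_pmf.prob P {\<omega>. card (comps \<omega> M) \<ge> 2}"
  proof (rule measure_pmf.finite_measure_mono)
    show "Pi (edges G) ?B \<subseteq> {\<omega>. card (comps \<omega> M) \<ge> 2}"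
    proof
      fix \<omega> assume \<omega>: "\<omega> \<in> Pi (edges G) ?B"
      have "card (comps \<omega> M) \<ge> 2"
      proof (rule card_components_ge_2[of _ C])
        fix e assume e: "e \<in> edges (layered_subgraph G \<omega> M)"
        then have "e \<in> edges G" "e \<notin> ?F"
          using \<omega> by (auto simp: edges_layered_subgraph Pi_def split: if_splits)
        then show "\<not> (ends (layered_subgraph G \<omega> M) e \<inter> C \<noteq> {} \<and>
            ends (layered_subgraph G \<omega> M) e \<inter> (verts (layered_subgraph G \<omega> M) - C) \<noteq> {})"
          by (simp add: cut_edges_def)
        show "ends (layered_subgraph G \<omega> M) e \<subseteq> verts (layered_subgraph G \<omega> M)"
          using ends_edge \<open>e \<in> edges G\<close> by simp
      qed (use C fin_verts in auto)
      then show "\<omega> \<in> {\<omega>. card (comps \<omega> M) \<ge> 2}"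
        by simp
    qed
  qed simp
  finally show ?thesis .
qed

section \<open>Combining decay and survival\<close>

text \<open>It is enough that \<open>(3 / 2) ^ m\<close> reaches \<open>2 * n\<^sup>2\<close>: then
  the left side is at most \<open>1 / (2 * n)\<close>, and \<open>\<epsilon> < 1\<close> does the
  rest.\<close>

lemma contraction_suffices:
  assumes "Suc m = L div 2" "\<epsilon> < 1"
  shows "n * (2 / 3) ^ m \<le> n powr (- \<epsilon>) / 2"
proof -
  have n: "n \<ge> 2"
    using two_verts by simp
  \<comment> \<open>The 3 is 2 for the \<open>Suc\<close> plus 1 for rounding down in
    \<open>L div 2\<close>.\<close>
  have "2 * real m + 3 \<ge> real L"
    using assms(1) by linarith
  then have m: "real m \<ge> 10 * log 2 n - 3 / 2"
    using L_bounds(1) by linarith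
  \<comment> \<open>Passing through \<open>sqrt 2\<close>, which is below 3/2, replaces an estimate
    of the logarithm of 3/2.\<close>
  have "2 * n\<^sup>2 = 2 powr (1 + 2 * log 2 n)"
    using n by (simp add: powr_add powr_mult_base powr_powr[symmetric] mult.commute[of 2] powr_numeral)
  also have "\<dots> \<le> 2 powr (real m / 2)"
    using m log_n_ge_1 by (intro powr_mono) auto
  also have "\<dots> = sqrt 2 ^ m"
    by (simp add: powr_half_sqrt[symmetric] powr_realpow[symmetric] powr_powr)
  also have "\<dots> \<le> (3 / 2) ^ m"
    by (intro power_mono real_le_lsqrt) (simp_all add: power2_eq_square)
  finally have "2 * n\<^sup>2 \<le> (3 / 2) ^ m" .
  then have "2 * n\<^sup>2 * (2 / 3) ^ m \<le> (3 / 2) ^ m * (2 / 3) ^ m"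
    by (intro mult_right_mono) auto
  also have "(3 / 2) ^ m * (2 / 3) ^ m = (1 :: real)"
    by (simp flip: power_mult_distrib)
  finally have "n * (2 / 3) ^ m \<le> 1 / n / 2"
    using n by (simp add: field_simps power2_eq_square)
  also have "1 / n = n powr (- 1)"
    using n by (simp add: powr_minus_divide)
  also have "\<dots> / 2 \<le> n powr (- \<epsilon>) / 2"
    using n assms(2) by (intro divide_right_mono powr_mono) auto
  finally show ?thesis .
qed

lemma prob_component_cut:
  assumes "\<epsilon> < 1"
  shows "n powr (- \<epsilon>) / 2 \<le>
    measure_pmf.prob P {\<omega>. \<exists>X\<in>component_cuts G \<omega>. minimum_cut (126 / \<epsilon>) G X}"
proof -
  define M where "M = L div 2"
  have M: "1 \<le> M" "2 * M \<le> L" "M - 1 < L" "Suc (M - 1) = M"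
    using L_bounds(3) by (auto simp: M_def)
  let ?good = "{\<omega>. \<exists>X\<in>component_cuts G \<omega>. minimum_cut (126 / \<epsilon>) G X}"
  \<comment> \<open>A graph still disconnected after layer \<open>M\<close> either had a small
    component cut in a layer before \<open>M\<close>, which is within the range of
    \<open>component_cuts\<close>, or has surplus at least 1. A union bound then leaves half of the
    survival probability.\<close>
  have sub: "{\<omega>. card (comps \<omega> M) \<ge> 2} \<subseteq> ?good \<union> {\<omega>. 1 \<le> surplus M \<omega>}"
  proof
    fix \<omega> assume two: "\<omega> \<in> {\<omega>. card (comps \<omega> M) \<ge> 2}"
    show "\<omega> \<in> ?good \<union> {\<omega>. 1 \<le> surplus M \<omega>}"
    proof (cases "no_small_before \<omega> M")
      case True
      then show ?thesis
        using two by (simp add: surplus_def)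
    next
      case False
      then obtain j C where j: "1 \<le> j" "j < M" "card (comps \<omega> j) \<ge> 2" "C \<in> comps \<omega> j"
        and small: "real (cut_size G (C, verts G - C)) \<le> 126 / \<epsilon> * real lam"
        unfolding no_small_before_def by (auto simp: not_less)
      have "(C, verts G - C) \<in> cuts G"
        using component_is_cut[OF j(3,4)] by (auto simp: cuts_def)
      moreover have "(C, verts G - C) \<in> component_cuts G \<omega>"
        using j M by (auto simp: component_cuts_def)
      ultimately show ?thesis
        using small by (auto simp: minimum_cut_def)
    qed
  qed
  have "measure_pmf.prob P {\<omega>. 1 \<le> surplus M \<omega>} \<le> measure_pmf.expectation P (surplus M) / 1"
    using integral_Markov_inequality_measure[of "measure_pmf P" "surplus M" UNIV 1] surplus_nonneg by simp
  also have "\<dots> \<le> n * (2 / 3) ^ (M - 1)"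
    using expectation_surplus_le[of "M - 1"] M by simp
  also have "\<dots> \<le> n powr (- \<epsilon>) / 2"
    using contraction_suffices[of "M - 1"] M assms by (simp add: M_def)
  finally have rare: "measure_pmf.prob P {\<omega>. 1 \<le> surplus M \<omega>} \<le> n powr (- \<epsilon>) / 2" .
  have "n powr (- \<epsilon>) \<le> measure_pmf.prob P {\<omega>. card (comps \<omega> M) \<ge> 2}"
    by (rule prob_disconnected[OF M(2)])
  also have "\<dots> \<le> measure_pmf.prob P (?good \<union> {\<omega>. 1 \<le> surplus M \<omega>})"
    by (intro measure_pmf.finite_measure_mono sub) simp
  also have "\<dots> \<le> measure_pmf.prob P ?good + measure_pmf.prob P {\<omega>. 1 \<le> surplus M \<omega>}"
    by (rule measure_Un_le) simp_all
  finally show ?thesis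
    using rare by simp
qed

end

theorem theorem4p2:
  shows "\<exists>c>0. \<forall>(G :: ('v, 'e) multigraph) (\<epsilon> :: real).
           finite_multigraph G \<longrightarrow> card (verts G) \<ge> 2 \<longrightarrow> edge_connectivity G > 0 \<longrightarrow>
           0 < \<epsilon> \<longrightarrow> \<epsilon> < 1 \<longrightarrow> sampling_prob \<epsilon> G \<le> 1 \<longrightarrow>
           measure_pmf.prob (layered_sampling \<epsilon> G)
             {\<omega>. \<exists>X\<in>component_cuts G \<omega>. minimum_cut (c / \<epsilon>) G X}
           \<ge> real (card (verts G)) powr (- \<epsilon>) / 2"
proof (rule exI[of _ 126], intro conjI allI impI)
  fix G :: "('v, 'e) multigraph" and \<epsilon> :: real
  assume "finite_multigraph G" "card (verts G) \<ge> 2" "edge_connectivity G > 0"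
    "0 < \<epsilon>" "\<epsilon> < 1" "sampling_prob \<epsilon> G \<le> 1"
  then interpret layered_cut_sampling G \<epsilon>
    by unfold_locales
  show "real (card (verts G)) powr (- \<epsilon>) / 2 \<le> measure_pmf.prob (layered_sampling \<epsilon> G)
      {\<omega>. \<exists>X\<in>component_cuts G \<omega>. minimum_cut (126 / \<epsilon>) G X}"
    by (rule prob_component_cut) fact
qed simp

end
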